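(* We have $$\sum_{n\geq1}c_n(2\text{-}11)t^n=\sum_{m\geq1}\frac{\left(\frac{1+t}{t}\right)^{(m+1)/2}}{t\,U_m\!\left(\frac{\sqrt{1+t}}{2\sqrt{t}}\right)U_{m+1}\!\left(\frac{\sqrt{1+t}}{2\sqrt{t}}\right)U_{m+2}\!\left(\frac{\sqrt{1+t}}{2\sqrt{t}}\right)}.$$
   Context: A Catalan word of length $n\ge 1$ is a sequence $\pi=\pi_1\cdots\pi_n$ of positive integers with $\pi_1=1$ and $\pi_{i+1}\le \pi_i+1$ for $1\le i\le n-1$; $\mathcal{C}_n$ is the set of these. A word $\pi$ contains the vincular pattern $2\text{-}11$ if there are indices $i<j$ with $j+1\le n$ such that $\pi_i>\pi_j=\pi_{j+1}$; otherwise $\pi$ avoids it. $c_n(\tau)$ denotes the number of members of $\mathcal{C}_n$ avoiding $\tau$. $U_n$ is the Chebyshev polynomial of the second kind: $U_0(x)=1$, $U_1(x)=2x$, $U_n(x)=2xU_{n-1}(x)-U_{n-2}(x)$ for $n\ge2$. The identity is one of power series in $t$; half-integer powers are powers of $\sqrt{1+t}/\sqrt t$, with the same $\sqrt t$ and $\sqrt{1+t}$ used throughout, and the square roots cancel so that each summand is a rational function of $t$, expanded about $t=0$. *)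

theory Defs
  imports "HOL-Computational_Algebra.Computational_Algebra"
begin

text \<open>Words are lists, indexed from 0.\<close>

definition catalan_words :: "nat \<Rightarrow> nat list set" where
  "catalan_words n =
     {w. n \<ge> 1 \<and> length w = n \<and> (\<forall>x\<in>set w. x \<ge> 1) \<and> w ! 0 = 1 \<and>
         (\<forall>i. i + 1 < n \<longrightarrow> w ! (i + 1) \<le> w ! i + 1)}"

definition contains_2_11 :: "nat list \<Rightarrow> bool" where
  "contains_2_11 w \<longleftrightarrow>
     (\<exists>i j. i < j \<and> j + 1 < length w \<and> w ! i > w ! j \<and> w ! j = w ! (j + 1))"

definition c_2_11 :: "nat \<Rightarrow> nat" where
  "c_2_11 n = card {w \<in> catalan_words n. \<not> contains_2_11 w}"

definition c_2_11_gf :: "rat fps" where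
  "c_2_11_gf = Abs_fps (\<lambda>n. if n \<ge> 1 then of_nat (c_2_11 n) else 0)"

fun chebyshev_U :: "nat \<Rightarrow> 'a :: comm_ring_1 poly" where
  "chebyshev_U 0 = 1"
| "chebyshev_U (Suc 0) = [:0, 2:]"
| "chebyshev_U (Suc (Suc n)) = [:0, 2:] * chebyshev_U (Suc n) - chebyshev_U n"

text \<open>
  Half-integer powers of \<open>t\<close> and \<open>1 + t\<close> live in the field of formal Laurent series in an
  indeterminate \<open>X\<close> (\<open>fls_X\<close>) with \<open>t = X ^ 2\<close>. A power series \<open>F(t)\<close> embeds into this field
  as \<open>F(X ^ 2)\<close>, and infinite sums are taken in the \<open>X\<close>-adic metric on Laurent series, which
  restricts to the usual topology of coefficientwise convergence on power series in \<open>t\<close>.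
\<close>

definition t_var :: "rat fls" where
  "t_var = fls_X ^ 2"

definition series_in_t :: "rat fps \<Rightarrow> rat fls" where
  "series_in_t F = fps_to_fls (F oo fps_X ^ 2)"

text \<open>
  The arguments \<open>s\<close> and \<open>u\<close> stand for the chosen square roots of \<open>t\<close> and \<open>1 + t\<close>.
\<close>

definition rhs_summand :: "rat fls \<Rightarrow> rat fls \<Rightarrow> nat \<Rightarrow> rat fls" where
  "rhs_summand s u m =
     (u / s) ^ (m + 1) /
     (t_var * poly (chebyshev_U m) (u / (2 * s))
            * poly (chebyshev_U (m + 1)) (u / (2 * s))
            * poly (chebyshev_U (m + 2)) (u / (2 * s)))"

lemma series_in_t_X: "series_in_t fps_X = t_var"
  by (simp add: series_in_t_def t_var_def fps_to_fls_power)

lemma square_roots_exist: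
  "\<exists>s u :: rat fls. s ^ 2 = t_var \<and> u ^ 2 = 1 + t_var"
proof -
  let ?v = "fps_binomial (1/2) :: rat fps"
  have "?v ^ 2 = fps_binomial 1"
    unfolding power2_eq_square by (simp flip: fps_binomial_add_mult)
  also have "\<dots> = 1 + fps_X"
    by (rule fps_binomial_1)
  finally have v: "?v ^ 2 = 1 + fps_X" .
  have "(series_in_t ?v) ^ 2 = series_in_t (?v ^ 2)"
    by (simp add: series_in_t_def fps_compose_power flip: fps_to_fls_power)
  also have "\<dots> = 1 + t_var"
    by (simp add: v series_in_t_def t_var_def fps_compose_add_distrib fps_to_fls_power)
  finally show ?thesis
    unfolding t_var_def by blast
qed

end

theory Submission
  imports Defs
begin

text \<open>
  The summand with index \<open>m\<close> counts the avoiding words whose largest letter is \<open>m\<close>.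

  Avoiding \<open>2-11\<close> means that a letter may be repeated immediately only if it equals the largest
  letter seen so far. Read from left to right, an avoiding word is therefore a walk on states
  \<open>(M, v)\<close>, with \<open>M\<close> the running maximum and \<open>v\<close> the last letter, starting at \<open>(1, 1)\<close>: the next
  letter \<open>x\<close> satisfies \<open>1 \<le> x \<le> v + 1\<close>, and \<open>x = v\<close> only if \<open>v = M\<close>. Fix the final maximum
  \<open>m\<close> and let \<open>F M v\<close> be the generating function, by length, of the walks from \<open>(M, v)\<close> that end
  with maximum \<open>m\<close>. Splitting off the first step gives
  \<open>F M v = [M = m] + t (\<Sum>x. F (max M x) x)\<close>, and this system determines every coefficient
  (\<open>extensions_gf_unique\<close>). So it suffices to exhibit a solution.

  For \<open>2 \<le> v < M\<close> the next letter cannot exceed \<open>M\<close>, and subtracting the equations for \<open>v\<close> and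
  \<open>v - 1\<close>, with \<open>f v = F M v\<close>, leaves the three-term recurrence \<open>t f(v + 1) = (1 + t) (f v - f(v - 1))\<close>. The substitution
  \<open>f v = (u / s)^v g(v)\<close> with \<open>s^2 = t\<close>, \<open>u^2 = 1 + t\<close> turns it into the Chebyshev recurrence at
  \<open>u / (2 s)\<close>. To stay within power series in \<open>t\<close>, the calculation uses
  \<open>B(m) = (u s)^m U(m)\<close>, which satisfies \<open>B(m + 2) = (1 + t) B(m + 1) - t (1 + t) B(m)\<close> and has
  constant term 1. In these terms, walks with maximum \<open>m\<close> throughout have generating function
  \<open>(1 + t)^v B(m + 1 - v) / B(m + 2)\<close>, and walks from \<open>v\<close> to \<open>M\<close> that never exceed \<open>M\<close> have
  \<open>(1 + t) t^(M - v) B(v) / B(M + 2)\<close>; that these solve the system comes down to two summation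
  identities for \<open>B\<close>, \<open>scaled_U_sum_down\<close> and \<open>scaled_U_sum_up\<close>. A walk from \<open>(1, 1)\<close> to maximum
  \<open>m\<close> passes through the records \<open>1, 2, ..., m\<close>, and the product over the records telescopes to
  \<open>t^m (1 + t)^(2 m + 2) / (B(m) B(m + 1) B(m + 2))\<close>, which is the summand rewritten in terms of \<open>B\<close>.
  As a word of length \<open>n\<close> has maximum at most \<open>n\<close>, every coefficient of the sum is reached after
  finitely many terms, so the sum converges.
\<close>

section \<open>Avoiding words as walks\<close>

definition next_letters :: "nat \<Rightarrow> nat \<Rightarrow> nat set" where
  "next_letters M v = {x. 1 \<le> x \<and> x \<le> v + 1 \<and> (x = v \<longrightarrow> M \<le> v)}"

fun extends :: "nat \<Rightarrow> nat \<Rightarrow> nat list \<Rightarrow> bool" where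
  "extends M v [] \<longleftrightarrow> True"
| "extends M v (x # xs) \<longleftrightarrow> x \<in> next_letters M v \<and> extends (max M x) x xs"

text \<open>
  A word of positive letters starting with 1 avoids \<open>2-11\<close> iff the second letter of each plateau is
  at least as large as all letters before it. For the induction on the word, the letters before
  \<open>v\<close> enter only through their maximum \<open>M\<close>.
\<close>

lemma extends_iff:
  assumes "v \<le> M"
  shows "extends M v xs \<longleftrightarrow>
    (\<forall>x\<in>set xs. x \<ge> 1) \<and> (\<forall>i<length xs. xs ! i \<le> (v # xs) ! i + 1) \<and>
    (\<forall>j<length xs. xs ! j = (v # xs) ! j \<longrightarrow> M \<le> xs ! j \<and> (\<forall>i<Suc j. (v # xs) ! i \<le> xs ! j))"
  using assms
proof (induction xs arbitrary: M v)
  case (Cons x xs)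
  have IH: "extends (max M x) x xs \<longleftrightarrow>
    (\<forall>x\<in>set xs. x \<ge> 1) \<and> (\<forall>i<length xs. xs ! i \<le> (x # xs) ! i + 1) \<and>
    (\<forall>j<length xs. xs ! j = (x # xs) ! j \<longrightarrow>
       max M x \<le> xs ! j \<and> (\<forall>i<Suc j. (x # xs) ! i \<le> xs ! j))"
    by (rule Cons.IH) simp
  have "M \<le> y \<and> (\<forall>i<Suc (Suc j). (v # x # xs) ! i \<le> y) \<longleftrightarrow>
        max M x \<le> y \<and> (\<forall>i<Suc j. (x # xs) ! i \<le> y)" for j y
    unfolding All_less_Suc2 using Cons.prems by auto
  then show ?case
    unfolding extends.simps IH using Cons.prems
    by (auto simp: All_less_Suc2 next_letters_def simp del: nth_Cons_Suc)
qed simp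

lemma avoiding_catalan_words_eq:
  assumes "n \<ge> 1"
  shows "{w \<in> catalan_words n. \<not> contains_2_11 w} =
    (#) 1 ` {xs. length xs = n - 1 \<and> extends 1 1 xs}"
proof -
  have *: "1 # xs \<in> catalan_words n \<and> \<not> contains_2_11 (1 # xs) \<longleftrightarrow>
      length xs = n - 1 \<and> extends 1 1 xs" for xs
  proof (cases "length xs = n - 1")
    case True
    have "1 # xs \<in> catalan_words n \<longleftrightarrow>
        (\<forall>x\<in>set xs. x \<ge> 1) \<and> (\<forall>i<length xs. xs ! i \<le> (1 # xs) ! i + 1)"
      using True assms unfolding catalan_words_def by auto
    moreover have "\<not> contains_2_11 (1 # xs) \<longleftrightarrow>
        (\<forall>j<length xs. xs ! j = (1 # xs) ! j \<longrightarrow> (\<forall>i<Suc j. (1 # xs) ! i \<le> xs ! j))"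
    proof -
      have "(1 # xs) ! (j + 1) = xs ! j" for j by simp
      then have "\<not> contains_2_11 (1 # xs) \<longleftrightarrow>
          (\<forall>j<length xs. xs ! j = (1 # xs) ! j \<longrightarrow> (\<forall>i<j. (1 # xs) ! i \<le> (1 # xs) ! j))"
        unfolding contains_2_11_def not_less[symmetric]
        by (metis Suc_eq_plus1 Suc_less_eq length_Cons)
      then show ?thesis by (metis less_Suc_eq order_refl)
    qed
    moreover have "(\<forall>x\<in>set xs. x \<ge> 1) \<Longrightarrow> j < length xs \<Longrightarrow> 1 \<le> xs ! j" for j
      using nth_mem by blast
    ultimately show ?thesis
      using True unfolding extends_iff[OF order_refl] by blast
  qed (auto simp: catalan_words_def)
  have "\<exists>xs. w = 1 # xs" if "w \<in> catalan_words n" for w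
    using that by (cases w) (auto simp: catalan_words_def)
  with * show ?thesis by blast
qed

text \<open>
  The continuations of length \<open>k\<close> from the state \<open>(M, v)\<close> that end with maximum \<open>m\<close>.
\<close>

definition extensions :: "nat \<Rightarrow> nat \<Rightarrow> nat \<Rightarrow> nat \<Rightarrow> nat list set" where
  "extensions m M v k = {xs. length xs = k \<and> extends M v xs \<and> fold max xs M = m}"

lemma finite_next_letters: "finite (next_letters M v)"
  by (rule finite_subset[of _ "{..v + 1}"]) (auto simp: next_letters_def)

lemma extensions_0: "extensions m M v 0 = (if M = m then {[]} else {})"
  by (auto simp: extensions_def)

lemma extensions_Suc:
  "extensions m M v (Suc k) =
    (\<Union>x\<in>next_letters M v. (#) x ` extensions m (max M x) x k)"
  by (auto simp: extensions_def length_Suc_conv max.commute)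

lemma finite_extensions: "finite (extensions m M v k)"
  by (induction k arbitrary: M v)
     (auto simp: extensions_0 extensions_Suc finite_next_letters)

lemma card_extensions_Suc:
  "card (extensions m M v (Suc k)) =
    (\<Sum>x\<in>next_letters M v. card (extensions m (max M x) x k))"
  unfolding extensions_Suc
  by (subst card_UN_disjoint)
     (auto simp: finite_next_letters finite_extensions card_image)

text \<open>
  Each letter exceeds its predecessor by at most one, so a single step raises the running maximum by
  at most one.
\<close>

lemma fold_max_bounds:
  assumes "extends M v xs" "v \<le> M"
  shows "M \<le> fold max xs M \<and> fold max xs M \<le> M + length xs"
  using assms
proof (induction xs arbitrary: M v)
  case (Cons x xs)
  have "x \<le> M + 1" using Cons.prems by (auto simp: next_letters_def)
  then show ?case
    using Cons.IH[of "max M x" x] Cons.prems by (auto simp: max.commute)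
qed simp

lemma c_2_11_eq_sum_max:
  assumes "n \<ge> 1" "N \<ge> n"
  shows "c_2_11 n = (\<Sum>m<N. card (extensions (m + 1) 1 1 (n - 1)))"
proof -
  have "{xs. length xs = n - 1 \<and> extends 1 1 xs} =
      (\<Union>m<N. extensions (m + 1) 1 1 (n - 1))"
  proof (intro equalityI subsetI)
    fix xs assume xs: "xs \<in> {xs. length xs = n - 1 \<and> extends 1 1 xs}"
    then have "1 \<le> fold max xs 1" "fold max xs 1 \<le> n"
      using fold_max_bounds[of 1 1 xs] assms by auto
    with xs assms have "fold max xs 1 - 1 < N" "xs \<in> extensions (fold max xs 1 - 1 + 1) 1 1 (n - 1)"
      by (auto simp: extensions_def)
    then show "xs \<in> (\<Union>m<N. extensions (m + 1) 1 1 (n - 1))" by blast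
  qed (auto simp: extensions_def)
  moreover have "card (\<Union>m<N. extensions (m + 1) 1 1 (n - 1)) =
      (\<Sum>m<N. card (extensions (m + 1) 1 1 (n - 1)))"
    by (subst card_UN_disjoint) (auto simp: finite_extensions, auto simp: extensions_def)
  ultimately show ?thesis
    unfolding c_2_11_def using assms by (simp add: avoiding_catalan_words_eq card_image)
qed

text \<open>
  Because of the factor \<open>fps_X\<close>, the coefficients of each positive degree are sums of
  coefficients one degree lower, by the same recursion as the numbers of continuations. This holds although the system has infinitely many
  unknowns.
\<close>

lemma extensions_gf_unique:
  fixes F :: "nat \<Rightarrow> nat \<Rightarrow> rat fps"
  assumes F: "\<And>M v. 1 \<le> v \<Longrightarrow> v \<le> M \<Longrightarrow>
    F M v = of_bool (M = m) + fps_X * (\<Sum>x\<in>next_letters M v. F (max M x) x)"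
  assumes "1 \<le> v" "v \<le> M"
  shows "fps_nth (F M v) k = of_nat (card (extensions m M v k))"
  using assms(2,3)
proof (induction k arbitrary: M v)
  case 0
  then show ?case by (subst F) (auto simp: extensions_0)
next
  case (Suc k)
  have "fps_nth (F M v) (Suc k) = (\<Sum>x\<in>next_letters M v. fps_nth (F (max M x) x) k)"
    using Suc.prems by (subst F) (auto simp: fps_sum_nth)
  also have "\<dots> = (\<Sum>x\<in>next_letters M v. of_nat (card (extensions m (max M x) x k)))"
    by (intro sum.cong refl Suc.IH) (auto simp: next_letters_def)
  finally show ?case by (simp add: card_extensions_Suc)
qed

section \<open>Rescaled Chebyshev polynomials\<close>

text \<open>
  The square of the root \<open>u\<close> of \<open>1 + t\<close>.
\<close>

abbreviation u2 :: "rat fps" where "u2 \<equiv> 1 + fps_X"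

text \<open>
  This is \<open>(u s)^m U(m)\<close> at \<open>u / (2 s)\<close>, see \<open>scaled_U_eq_chebyshev\<close>. Scaling by \<open>s^m\<close> removes the
  negative powers of \<open>t\<close>, and scaling by \<open>u^m\<close> as well removes the square root of \<open>1 + t\<close> that would
  remain for odd \<open>m\<close>.
\<close>

fun scaled_U :: "nat \<Rightarrow> rat fps" where
  "scaled_U 0 = 1"
| "scaled_U (Suc 0) = u2"
| "scaled_U (Suc (Suc m)) = u2 * scaled_U (Suc m) - fps_X * u2 * scaled_U m"

lemma scaled_U_nth_0: "fps_nth (scaled_U m) 0 = 1"
  by (induction m rule: scaled_U.induct) auto

lemma scaled_U_inverse: "scaled_U m * inverse (scaled_U m) = 1"
  using inverse_mult_eq_1[of "scaled_U m"] by (simp add: mult.commute scaled_U_nth_0)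

text \<open>
  The system for walks from \<open>v\<close> to \<open>M\<close> below the maximum, with common factors cancelled: a step
  leads to \<open>v + 1\<close> or to some \<open>w < v\<close>, never to \<open>v\<close> itself.
\<close>

lemma scaled_U_sum_up:
  assumes "1 \<le> v"
  shows "scaled_U (v + 1) + (\<Sum>w\<in>{1..<v}. fps_X ^ (v + 1 - w) * scaled_U w) = scaled_U v"
  using assms
proof (induction v rule: nat_induct_at_least)
  case base
  show ?case by (simp add: algebra_simps)
next
  case (Suc v)
  have "(\<Sum>w\<in>{1..<Suc v}. fps_X ^ (Suc v + 1 - w) * scaled_U w) =
      fps_X ^ 2 * scaled_U v + fps_X * (\<Sum>w\<in>{1..<v}. fps_X ^ (v + 1 - w) * scaled_U w)"
    using Suc.hyps by (simp add: sum_distrib_left Suc_diff_le mult.assoc power2_eq_square)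
  also have "(\<Sum>w\<in>{1..<v}. fps_X ^ (v + 1 - w) * scaled_U w) = scaled_U v - scaled_U (v + 1)"
    using Suc.IH by (simp add: algebra_simps)
  finally show ?case by (simp add: algebra_simps power2_eq_square)
qed

text \<open>
  The same system for walks with arbitrary last letter, where the solution runs through the indices
  of \<open>scaled_U\<close> in the opposite direction.
\<close>

lemma scaled_U_sum_down:
  assumes "1 \<le> v" "v \<le> m"
  shows "scaled_U (m + 2) + fps_X * ((\<Sum>w\<in>{1..<v}. u2 ^ w * scaled_U (m + 1 - w))
           + u2 ^ (v + 1) * scaled_U (m - v)) = u2 ^ v * scaled_U (m + 1 - v)"
  using assms
proof (induction v rule: nat_induct_at_least)
  case base
  then obtain k where "m = Suc k" by (cases m) auto
  then show ?case by (simp add: algebra_simps power2_eq_square)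
next
  case (Suc v)
  then obtain k where k: "m = Suc v + k" using le_Suc_ex by blast
  have IH: "scaled_U (m + 2) + fps_X * ((\<Sum>w\<in>{1..<v}. u2 ^ w * scaled_U (m + 1 - w))
           + u2 ^ (v + 1) * scaled_U (k + 1)) = u2 ^ v * scaled_U (k + 2)"
    using Suc.IH Suc.prems by (simp add: k)
  have s: "(\<Sum>w\<in>{1..<Suc v}. u2 ^ w * scaled_U (m + 1 - w)) =
    (\<Sum>w\<in>{1..<v}. u2 ^ w * scaled_U (m + 1 - w)) + u2 ^ v * scaled_U (k + 2)"
    using Suc.hyps by (simp add: k)
  have i: "m - Suc v = k" "m + 1 - Suc v = k + 1" by (auto simp: k)
  have rec: "scaled_U (k + 2) = u2 * scaled_U (k + 1) - fps_X * u2 * scaled_U k" by simp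
  have p: "u2 ^ (v + 1) = u2 * u2 ^ v" "u2 ^ (Suc v + 1) = u2 * u2 * u2 ^ v" "u2 ^ Suc v = u2 * u2 ^ v"
    by (simp_all add: mult.assoc)
  have "D + fps_X * (S + P * (u2 * y - fps_X * u2 * x) + u2 * u2 * P * x) = u2 * P * y"
    if "D + fps_X * (S + u2 * P * y) = P * (u2 * y - fps_X * u2 * x)" for D S P x y :: "rat fps"
    using that by algebra
  from this[OF IH[unfolded p rec]] show ?case unfolding s i p rec .
qed

section \<open>Generating functions of the extensions\<close>

text \<open>
  For \<open>1 \<le> v \<le> M\<close>, this counts the continuations from \<open>(M, v)\<close> that end in the letter \<open>M\<close> and never
  exceed \<open>M\<close>, the empty one included if \<open>v = M\<close>.
\<close>

definition returns :: "nat \<Rightarrow> nat \<Rightarrow> rat fps" where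
  "returns M v = u2 * fps_X ^ (M - v) * scaled_U v * inverse (scaled_U (M + 2))"

text \<open>
  For \<open>1 \<le> v \<le> m\<close>, this counts the continuations from \<open>(m, v)\<close> that never exceed \<open>m\<close>.
\<close>

definition stays :: "nat \<Rightarrow> nat \<Rightarrow> rat fps" where
  "stays m v = u2 ^ v * scaled_U (m + 1 - v) * inverse (scaled_U (m + 2))"

text \<open>
  For \<open>1 \<le> M \<le> m\<close>, this counts the continuations from the record \<open>(M, M)\<close> with final maximum \<open>m\<close>.
  It is the product of \<open>fps_X * returns k k\<close> for \<open>M \<le> k < m\<close> with \<open>stays m m\<close>, after telescoping.
\<close>

definition record_gf :: "nat \<Rightarrow> nat \<Rightarrow> rat fps" where
  "record_gf m M = (u2 * fps_X) ^ (m - M) * scaled_U M * scaled_U (M + 1) * u2 ^ (m + 1) *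
     inverse (scaled_U m) * inverse (scaled_U (m + 1)) * inverse (scaled_U (m + 2))"

text \<open>
  A walk from \<open>(M, v)\<close> to a larger maximum splits at its first step to \<open>M + 1\<close>, which it takes from
  the letter \<open>M\<close>.
\<close>

definition max_gf :: "nat \<Rightarrow> nat \<Rightarrow> nat \<Rightarrow> rat fps" where
  "max_gf m M v =
    (if M < m then fps_X * returns M v * record_gf m (M + 1)
     else if M = m then stays m v else 0)"

lemma returns_below:
  assumes "1 \<le> v" "v < M"
  shows "returns M v = fps_X * ((\<Sum>w\<in>{1..<v}. returns M w) + returns M (v + 1))"
proof -
  define R where "R = u2 * fps_X ^ (M - v) * inverse (scaled_U (M + 2))"
  have w: "fps_X * returns M w = R * (fps_X ^ (v + 1 - w) * scaled_U w)" if "w \<le> v + 1" for w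
  proof -
    have "Suc (M - w) = (M - v) + (v + 1 - w)" using that assms by simp
    then have "fps_X * fps_X ^ (M - w) = fps_X ^ (M - v) * (fps_X ^ (v + 1 - w) :: rat fps)"
      by (metis power_Suc power_add)
    moreover have "fps_X * (u2 * y * z * i) = u2 * x * i * (q * z)"
      if "fps_X * y = x * q" for x y z i q :: "rat fps"
      using that by algebra
    ultimately show ?thesis unfolding returns_def R_def by blast
  qed
  have "fps_X * ((\<Sum>w\<in>{1..<v}. returns M w) + returns M (v + 1)) =
      R * ((\<Sum>w\<in>{1..<v}. fps_X ^ (v + 1 - w) * scaled_U w) + scaled_U (v + 1))"
    using w[of "v + 1"] by (simp add: distrib_left sum_distrib_left w)
  also have "\<dots> = R * scaled_U v"
    using scaled_U_sum_up[OF assms(1)] by (simp add: add.commute)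
  also have "\<dots> = returns M v" by (simp add: R_def returns_def mult_ac)
  finally show ?thesis ..
qed

lemma returns_record:
  assumes "1 \<le> M"
  shows "returns M M = 1 + fps_X * (\<Sum>w\<in>{1..M}. returns M w)"
proof -
  define R where "R = u2 * inverse (scaled_U (M + 2))"
  have w: "fps_X * returns M w = R * (fps_X ^ (M + 1 - w) * scaled_U w)" if "w \<le> M" for w
    using that unfolding returns_def R_def by (simp add: Suc_diff_le mult_ac)
  have "{1..M} = insert M {1..<M}" using assms by auto
  then have "fps_X * (\<Sum>w\<in>{1..M}. returns M w) =
      R * ((\<Sum>w\<in>{1..<M}. fps_X ^ (M + 1 - w) * scaled_U w) + fps_X * scaled_U M)"
    using w[of M] by (simp add: distrib_left sum_distrib_left w add.commute)
  also have "(\<Sum>w\<in>{1..<M}. fps_X ^ (M + 1 - w) * scaled_U w) = scaled_U M - scaled_U (M + 1)"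
    using scaled_U_sum_up[OF assms(1)] by (simp add: algebra_simps)
  finally have 1: "fps_X * (\<Sum>w\<in>{1..M}. returns M w) =
      R * (scaled_U M - scaled_U (M + 1) + fps_X * scaled_U M)" .
  have 2: "returns M M = R * scaled_U M" by (simp add: returns_def R_def mult_ac)
  have 3: "R * (scaled_U (M + 1) - fps_X * scaled_U M) = 1"
    using scaled_U_inverse[of "M + 2"] unfolding R_def by (simp add: algebra_simps)
  show ?thesis unfolding 1 2 using 3 by algebra
qed

text \<open>
  The case \<open>v = m\<close> is included: there \<open>stays m (m + 1)\<close> has no combinatorial meaning and is just the
  value of the formula.
\<close>

lemma stays_below:
  assumes "1 \<le> v" "v \<le> m"
  shows "stays m v = 1 + fps_X * ((\<Sum>w\<in>{1..<v}. stays m w) + stays m (v + 1))"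
proof -
  let ?R = "inverse (scaled_U (m + 2))"
  have "stays m v = ?R * (u2 ^ v * scaled_U (m + 1 - v))"
    by (simp add: stays_def mult_ac)
  also have "\<dots> = ?R * (scaled_U (m + 2) +
      fps_X * ((\<Sum>w\<in>{1..<v}. u2 ^ w * scaled_U (m + 1 - w)) + u2 ^ (v + 1) * scaled_U (m - v)))"
    by (simp only: scaled_U_sum_down[OF assms])
  also have "\<dots> = scaled_U (m + 2) * ?R +
      fps_X * ((\<Sum>w\<in>{1..<v}. ?R * (u2 ^ w * scaled_U (m + 1 - w))) +
        ?R * (u2 ^ (v + 1) * scaled_U (m - v)))"
    unfolding sum_distrib_left[symmetric] by algebra
  finally show ?thesis
    unfolding scaled_U_inverse by (simp add: stays_def mult_ac)
qed

text \<open>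
  From the record \<open>m\<close> the walk may repeat \<open>m\<close> but not go up, so \<open>stays m m\<close> replaces
  \<open>stays m (m + 1)\<close> in the sum. The closed form takes equal values at these two arguments, so the
  boundary equation is the interior one.
\<close>

lemma stays_record:
  assumes "1 \<le> m"
  shows "stays m m = 1 + fps_X * (\<Sum>w\<in>{1..m}. stays m w)"
proof -
  have "stays m (m + 1) = stays m m" by (simp add: stays_def mult_ac)
  moreover have "{1..m} = insert m {1..<m}" using assms by auto
  ultimately show ?thesis using stays_below[OF assms order_refl] by (simp add: add.commute)
qed

lemma record_gf_top: "record_gf m m = stays m m"
proof -
  have "record_gf m m = (scaled_U m * inverse (scaled_U m)) *
      (scaled_U (m + 1) * inverse (scaled_U (m + 1))) * (u2 ^ (m + 1) * inverse (scaled_U (m + 2)))"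
    unfolding record_gf_def by (simp add: mult_ac)
  then show ?thesis unfolding scaled_U_inverse by (simp add: stays_def mult_ac)
qed

lemma record_gf_step:
  assumes "M < m"
  shows "record_gf m M = fps_X * returns M M * record_gf m (M + 1)"
proof -
  have p: "(u2 * fps_X) ^ (m - M) = (u2 * fps_X) * (u2 * fps_X) ^ (m - (M + 1))"
    using assms by (metis Suc_diff_Suc Suc_eq_plus1 power_Suc)
  have i: "M + 1 + 1 = M + 2" by simp
  have "u2 * fps_X * P * B * C * D * I * J * K =
      fps_X * (u2 * 1 * B * L) * (P * C * E * D * I * J * K)"
    if "E * L = 1" for P B C D E I J K L :: "rat fps"
  proof -
    have "u2 * fps_X * P * B * C * D * I * J * K =
        (E * L) * (u2 * fps_X * P * B * C * D * I * J * K)"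
      using that by simp
    also have "\<dots> = fps_X * (u2 * 1 * B * L) * (P * C * E * D * I * J * K)"
      by (simp only: mult_ac mult_1_left mult_1_right)
    finally show ?thesis .
  qed
  from this[OF scaled_U_inverse[of "M + 2"]] show ?thesis
    unfolding record_gf_def returns_def p i diff_self_eq_0 power_0 .
qed

lemma max_gf_record:
  "M \<le> m \<Longrightarrow> max_gf m M M = record_gf m M"
  by (auto simp: max_gf_def record_gf_top record_gf_step)

lemma next_letters_eq:
  assumes "1 \<le> v" "v \<le> M"
  shows "next_letters M v = (if v < M then insert (v + 1) {1..<v} else insert (v + 1) {1..v})"
  using assms by (auto simp: next_letters_def)

text \<open>
  Below the record the walk keeps its maximum, so the equations for \<open>returns\<close> and \<open>stays\<close> carry
  over. At the record \<open>v = M < m\<close>, the step to \<open>M + 1\<close> contributes \<open>record_gf m (M + 1)\<close>, which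
  is the factor that multiplies the constant 1 in \<open>returns_record\<close>.
\<close>

lemma max_gf_eq:
  assumes "1 \<le> v" "v \<le> M"
  shows "max_gf m M v = of_bool (M = m) + fps_X * (\<Sum>x\<in>next_letters M v. max_gf m (max M x) x)"
proof (cases "v < M")
  case True
  have "(\<Sum>x\<in>next_letters M v. max_gf m (max M x) x) = (\<Sum>x\<in>next_letters M v. max_gf m M x)"
  proof (intro sum.cong refl)
    fix x assume "x \<in> next_letters M v"
    then have "max M x = M" using True by (auto simp: next_letters_def)
    then show "max_gf m (max M x) x = max_gf m M x" by simp
  qed
  also have "\<dots> = (\<Sum>x\<in>{1..<v}. max_gf m M x) + max_gf m M (v + 1)"
    using True assms by (simp add: next_letters_eq add.commute)
  finally have s: "(\<Sum>x\<in>next_letters M v. max_gf m (max M x) x) = \<dots>" .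
  consider "M < m" | "M = m" | "M > m" by linarith
  then show ?thesis
  proof cases
    case 1
    have "max_gf m M v = fps_X * record_gf m (M + 1) * returns M v"
      using 1 by (simp add: max_gf_def mult_ac)
    also have "\<dots> = fps_X * ((\<Sum>w\<in>{1..<v}. fps_X * returns M w * record_gf m (M + 1)) +
        fps_X * returns M (v + 1) * record_gf m (M + 1))"
      unfolding returns_below[OF assms(1) True] sum_distrib_left[symmetric]
        sum_distrib_right[symmetric] by algebra
    finally show ?thesis unfolding s using 1 by (simp add: max_gf_def)
  next
    case 2
    then show ?thesis
      unfolding s using stays_below[of v m] assms by (simp add: max_gf_def)
  next
    case 3
    then show ?thesis unfolding s by (simp add: max_gf_def)
  qed
next
  case False
  then have v: "v = M" using assms by simp
  have "(\<Sum>x\<in>next_letters M v. max_gf m (max M x) x) =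
      (\<Sum>x\<in>{1..M}. max_gf m (max M x) x) + max_gf m (M + 1) (M + 1)"
    using assms by (simp add: next_letters_eq v add.commute max_def)
  also have "(\<Sum>x\<in>{1..M}. max_gf m (max M x) x) = (\<Sum>x\<in>{1..M}. max_gf m M x)"
    by (intro sum.cong) (auto simp: max_def)
  finally have s: "(\<Sum>x\<in>next_letters M v. max_gf m (max M x) x) =
      (\<Sum>x\<in>{1..M}. max_gf m M x) + max_gf m (M + 1) (M + 1)" .
  consider "M < m" | "M = m" | "M > m" by linarith
  then show ?thesis
  proof cases
    case 1
    have "(\<Sum>x\<in>{1..M}. max_gf m M x) + max_gf m (M + 1) (M + 1) =
        (fps_X * (\<Sum>x\<in>{1..M}. returns M x)) * record_gf m (M + 1) + record_gf m (M + 1)"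
      using 1 max_gf_record[of "M + 1" m]
      by (simp add: max_gf_def sum_distrib_left sum_distrib_right)
    also have "\<dots> = returns M M * record_gf m (M + 1)"
      using returns_record[of M] assms by (simp add: v algebra_simps)
    finally show ?thesis unfolding s using 1 by (simp add: max_gf_def v mult_ac)
  next
    case 2
    then show ?thesis
      unfolding s using stays_record[of m] assms by (simp add: max_gf_def v)
  next
    case 3
    then show ?thesis unfolding s by (simp add: max_gf_def)
  qed
qed

lemma extensions_gf:
  assumes "1 \<le> v" "v \<le> M"
  shows "fps_nth (max_gf m M v) k = of_nat (card (extensions m M v k))"
  using extensions_gf_unique[OF max_gf_eq assms] .

section \<open>Summation over the maximum\<close>

text \<open>
  The summand of the theorem as a power series in \<open>t\<close>, see \<open>rhs_summand_eq\<close>.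
\<close>

definition summand :: "nat \<Rightarrow> rat fps" where
  "summand m = fps_X ^ m * u2 ^ (2 * m + 2) *
     inverse (scaled_U m) * inverse (scaled_U (m + 1)) * inverse (scaled_U (m + 2))"

text \<open>
  The extra \<open>fps_X\<close> accounts for the initial letter 1 of the word.
\<close>

lemma summand_eq_max_gf:
  assumes "1 \<le> m"
  shows "summand m = fps_X * max_gf m 1 1"
proof -
  obtain k where k: "m = Suc k" using assms by (cases m) auto
  have "scaled_U (1 + 1) = u2" by (simp add: algebra_simps)
  then have "fps_X * max_gf m 1 1 = fps_X * ((u2 * fps_X) ^ k * u2 * u2 * u2 ^ (m + 1) *
     inverse (scaled_U m) * inverse (scaled_U (m + 1)) * inverse (scaled_U (m + 2)))"
    using max_gf_record[OF assms] by (simp add: record_gf_def k del: scaled_U.simps(3))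
  also have "fps_X * ((u2 * fps_X) ^ k * u2 * u2 * u2 ^ (m + 1) *
     inverse (scaled_U m) * inverse (scaled_U (m + 1)) * inverse (scaled_U (m + 2))) =
     (fps_X * fps_X ^ k) * (u2 ^ k * u2 * u2 * u2 ^ (m + 1)) *
     inverse (scaled_U m) * inverse (scaled_U (m + 1)) * inverse (scaled_U (m + 2))"
    by (simp only: power_mult_distrib mult_ac)
  also have "u2 ^ k * u2 * u2 * u2 ^ (m + 1) = u2 ^ (2 * m + 2)"
  proof -
    have "2 * m + 2 = k + 1 + 1 + (m + 1)" by (simp add: k)
    then show ?thesis by (simp only: power_add power_one_right)
  qed
  also have "fps_X * fps_X ^ k = (fps_X ^ m :: rat fps)" by (simp add: k)
  finally show ?thesis by (simp add: summand_def)
qed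

lemma summand_sums: "(\<lambda>k. summand (k + 1)) sums c_2_11_gf"
  unfolding sums_def
proof (rule tendsto_fpsI)
  fix n
  show "\<forall>\<^sub>F N in sequentially. fps_nth (\<Sum>k<N. summand (k + 1)) n = fps_nth c_2_11_gf n"
    using eventually_ge_at_top[of n]
  proof eventually_elim
    case (elim N)
    show ?case
    proof (cases n)
      case 0
      then show ?thesis by (simp add: c_2_11_gf_def fps_sum_nth summand_eq_max_gf)
    next
      case (Suc l)
      have "fps_nth (summand (k + 1)) n = of_nat (card (extensions (k + 1) 1 1 (n - 1)))" for k
        using extensions_gf[of 1 1 "k + 1" l] by (simp add: summand_eq_max_gf Suc)
      then show ?thesis
        using c_2_11_eq_sum_max[of n N] elim Suc by (simp add: fps_sum_nth c_2_11_gf_def)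
    qed
  qed
qed

section \<open>Substitution of a squared variable in Laurent series\<close>

lemma series_in_t_mult: "series_in_t (F * G) = series_in_t F * series_in_t G"
  by (simp add: series_in_t_def fps_compose_mult_distrib fls_times_fps_to_fls)

lemma series_in_t_diff: "series_in_t (F - G) = series_in_t F - series_in_t G"
  by (simp add: series_in_t_def fps_compose_sub_distrib)

lemma series_in_t_1: "series_in_t 1 = 1"
  by (simp add: series_in_t_def)

lemma series_in_t_u2: "series_in_t u2 = 1 + t_var"
  using series_in_t_X by (simp add: series_in_t_def fps_compose_add_distrib)

lemma series_in_t_power: "series_in_t (F ^ n) = series_in_t F ^ n"
  by (induction n) (simp_all add: series_in_t_1 series_in_t_mult)

lemma series_in_t_sum: "series_in_t (sum f A) = (\<Sum>x\<in>A. series_in_t (f x))"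
  by (induction A rule: infinite_finite_induct)
     (auto simp: series_in_t_def fps_compose_add_distrib)

lemma dist_fps_to_fls: "dist (fps_to_fls f) (fps_to_fls g) = dist f g"
proof -
  have "fls_subdegree (fps_to_fls f - fps_to_fls g) = int (subdegree (f - g))"
    by (simp flip: fps_to_fls_minus add: fls_subdegree_fls_to_fps)
  then show ?thesis by (simp add: dist_fls_def dist_fps_def)
qed

text \<open>
  Both topologies are given by the order of vanishing: the embedding of power series into Laurent
  series is isometric, and a coefficient of \<open>F(X^2)\<close> depends on only finitely many coefficients
  of \<open>F\<close>.
\<close>

lemma tendsto_series_in_t:
  assumes "(f \<longlongrightarrow> g) F"
  shows "((\<lambda>x. series_in_t (f x)) \<longlongrightarrow> series_in_t g) F"
proof -
  have "((\<lambda>x. f x oo fps_X ^ 2) \<longlongrightarrow> g oo fps_X ^ 2) F"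
  proof (rule tendsto_fpsI)
    fix n
    have "\<forall>\<^sub>F x in F. \<forall>i\<in>{0..n}. fps_nth (f x) i = fps_nth g i"
      using assms unfolding tendsto_fps_iff by (subst eventually_ball_finite_distrib) auto
    then show "\<forall>\<^sub>F x in F. fps_nth (f x oo fps_X ^ 2) n = fps_nth (g oo fps_X ^ 2) n"
      by eventually_elim (simp add: fps_compose_nth)
  qed
  then show ?thesis
    unfolding series_in_t_def tendsto_iff dist_fps_to_fls .
qed

lemma scaled_U_eq_chebyshev:
  fixes s u :: "rat fls"
  assumes "s ^ 2 = t_var" "u ^ 2 = 1 + t_var" "s \<noteq> 0"
  shows "series_in_t (scaled_U m) = (u * s) ^ m * poly (chebyshev_U m) (u / (2 * s))"
proof (induction m rule: scaled_U.induct)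
  case 1
  show ?case by (simp add: series_in_t_1)
next
  case 2
  show ?case using assms by (simp add: series_in_t_u2 power2_eq_square)
next
  case (3 m)
  let ?p = "\<lambda>k. poly (chebyshev_U k) (u / (2 * s))"
  have "series_in_t (scaled_U (Suc (Suc m))) =
      u ^ 2 * ((u * s) ^ Suc m * ?p (Suc m)) - s ^ 2 * u ^ 2 * ((u * s) ^ m * ?p m)"
    using 3 by (simp add: series_in_t_mult series_in_t_diff series_in_t_u2 series_in_t_X assms
        del: power_Suc)
  also have "\<dots> = (u * s) ^ Suc (Suc m) * (u / s * ?p (Suc m) - ?p m)"
    using assms(3) by (simp add: field_simps power2_eq_square)
  finally show ?case by simp
qed

lemma t_var_nonzero: "t_var \<noteq> 0" "1 + t_var \<noteq> 0"
proof -
  show "t_var \<noteq> 0" by (simp add: t_var_def)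
  have "fps_to_fls (u2 oo fps_X ^ 2) \<noteq> 0"
    by (metis fps_to_fls_eq_0_iff fps_compose_nth_0 fps_zero_nth scaled_U_nth_0
        scaled_U.simps(2) zero_neq_one)
  then show "1 + t_var \<noteq> 0" using series_in_t_u2 unfolding series_in_t_def by metis
qed

lemma rhs_summand_eq:
  fixes s u :: "rat fls"
  assumes "s ^ 2 = t_var" "u ^ 2 = 1 + t_var"
  shows "rhs_summand s u m = series_in_t (summand m)"
proof -
  have s: "s \<noteq> 0" and u: "u \<noteq> 0"
    using assms t_var_nonzero by auto
  define b where "b k = series_in_t (scaled_U k)" for k
  have inv: "series_in_t (inverse (scaled_U k)) = inverse (b k)" for k
    unfolding b_def using scaled_U_inverse[of k]
    by (metis inverse_unique series_in_t_1 series_in_t_mult)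
  have nz: "b k \<noteq> 0" for k
    using scaled_U_inverse[of k] unfolding b_def
    by (metis mult_zero_left series_in_t_1 series_in_t_mult zero_neq_one)
  have p: "poly (chebyshev_U k) (u / (2 * s)) = b k / (u * s) ^ k" for k
    using scaled_U_eq_chebyshev[OF assms s, of k] s u by (simp add: b_def)
  have "rhs_summand s u m =
      (u / s) ^ (m + 1) * ((u * s) ^ m * (u * s) ^ (m + 1) * (u * s) ^ (m + 2)) /
        (s ^ 2 * b m * b (m + 1) * b (m + 2))"
    unfolding rhs_summand_def p assms(1)[symmetric] using s u nz by (simp add: field_simps)
  also have "(u / s) ^ (m + 1) * ((u * s) ^ m * (u * s) ^ (m + 1) * (u * s) ^ (m + 2)) =
      s ^ 2 * (s ^ 2) ^ m * (u ^ 2) ^ (2 * m + 2)"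
    using s by (simp add: field_simps power_mult_distrib flip: power_mult power_add)
      (simp add: mult_ac power_add power2_eq_square power_mult power4_eq_xxxx)
  also have "s ^ 2 * (s ^ 2) ^ m * (u ^ 2) ^ (2 * m + 2) / (s ^ 2 * b m * b (m + 1) * b (m + 2)) =
      t_var ^ m * (1 + t_var) ^ (2 * m + 2) *
        inverse (b m) * inverse (b (m + 1)) * inverse (b (m + 2))"
    unfolding assms using t_var_nonzero(1) by (simp add: divide_inverse mult_ac)
  also have "\<dots> = series_in_t (summand m)"
    by (simp only: summand_def series_in_t_mult series_in_t_power series_in_t_X series_in_t_u2 inv)
  finally show ?thesis .
qed

theorem theorem2p6:
  fixes s u :: "rat fls"
  assumes "s ^ 2 = t_var" and "u ^ 2 = 1 + t_var"
  shows "(\<lambda>k. rhs_summand s u (k + 1)) sums series_in_t c_2_11_gf"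
  using tendsto_series_in_t[OF summand_sums[unfolded sums_def]]
  by (simp add: sums_def rhs_summand_eq[OF assms] series_in_t_sum)

end
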